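(* Consider, for step sets $X\subseteq\mathbb{Z}^2\setminus\{O\}$ and submonoids $\mathcal{C}$ of $\mathbb{Z}^2$, the following seven implications: (1) $X$ satisfies CC $\Rightarrow$ $X$ satisfies SLC; (2) $X$ satisfies SLC $\Rightarrow$ $X$ satisfies LC; (3) $(X,\mathcal{C})$ has the FPP $\Rightarrow$ $(X,\mathcal{C})$ has the BPP; (4) $(X,\mathcal{C})$ has the BPP $\Rightarrow$ $(X,\mathcal{C})$ does not have the IPP; (5) $X$ satisfies CC $\Rightarrow$ $(X,\mathcal{C})$ has the FPP; (6) $X$ satisfies SLC $\Rightarrow$ $(X,\mathcal{C})$ has the BPP; (7) $X$ satisfies LC $\Rightarrow$ $(X,\mathcal{C})$ does not have the IPP. Then: (i) All of (1)–(7) hold for an arbitrary step set $X\subseteq\mathbb{Z}^2\setminus\{O\}$ and an arbitrary submonoid $\mathcal{C}$ of $\mathbb{Z}^2$. (ii) For finite $X$ (and an arbitrary submonoid $\mathcal{C}$ of $\mathbb{Z}^2$), the implications (1), (2) and (3) are reversible, i.e. their converses also hold; whereas (4), (5), (6) and (7) are not reversible in general, i.e. for each of these four there is a pair $(X,\mathcal{C})$, with $X$ a finite step set and $\mathcal{C}$ a submonoid of $\mathbb{Z}^2$, for which the converse fails. (iii) In general (for arbitrary, possibly infinite, step sets $X$), none of (1)–(7) is reversible, i.e. for each of them there is a pair $(X,\mathcal{C})$, with $X$ a step set and $\mathcal{C}$ a submonoid of $\mathbb{Z}^2$, for which the converse fails.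
   Context: Write $O=(0,0)$. A step set is any (finite or infinite) subset $X$ of $\mathbb{Z}^2\setminus\{O\}$. $\mathcal{F}_X$ is the free monoid on $X$ (all finite words over $X$, including the empty word), with $\ell(w)$ the length of $w$; for $w=A_1\cdots A_k\in\mathcal{F}_X$ put $\alpha_X(w)=A_1+\cdots+A_k\in\mathbb{Z}^2$ and, for $0\le m\le k$, $\sigma_m(w)=A_1\cdots A_m$ (initial subword). For $\mathcal{C}\subseteq\mathbb{Z}^2$ with $O\in\mathcal{C}$, define $$\mathcal{F}_X^{\mathcal{C}}=\{w\in\mathcal{F}_X:\alpha_X(\sigma_m(w))\in\mathcal{C}\text{ for all }0\le m\le\ell(w)\},\qquad \mathcal{A}_X^{\mathcal{C}}=\alpha_X(\mathcal{F}_X^{\mathcal{C}}),$$ and for $A\in\mathbb{Z}^2$ let $\Pi_X^{\mathcal{C}}(A)=\{w\in\mathcal{F}_X^{\mathcal{C}}:\alpha_X(w)=A\}$ and $\pi_X^{\mathcal{C}}(A)=|\Pi_X^{\mathcal{C}}(A)|$. $(X,\mathcal{C})$ has the FPP if $\pi_X^{\mathcal{C}}(A)<\infty$ for all $A\in\mathcal{A}_X^{\mathcal{C}}$; the IPP if $\pi_X^{\mathcal{C}}(A)=\infty$ for all $A\in\mathcal{A}_X^{\mathcal{C}}$; the BPP if for every $A\in\mathcal{A}_X^{\mathcal{C}}$ the set $\{\ell(w):w\in\Pi_X^{\mathcal{C}}(A)\}$ is finite. A line splits $\mathbb{R}^2$ into two open half-planes, which are opposites of each other. A cone is an intersection of two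 open half-planes whose bounding lines are not parallel; its vertex is the intersection point of these lines. $X$ satisfies the LC (Line Condition) if it is contained in an open half-plane bounded by a line through $O$; the SLC (Strong Line Condition) if it is contained in an open half-plane whose opposite open half-plane contains $O$; the CC (Cone Condition) if it is contained in a cone with vertex $O$. *)

theory Defs
  imports "HOL-Analysis.Analysis"
begin

type_synonym lattice = "int \<times> int"
type_synonym plane = "real \<times> real"

subsection \<open>Words and the finiteness properties\<close>

definition step_set :: "lattice set \<Rightarrow> bool" where
  "step_set X \<longleftrightarrow> X \<subseteq> UNIV - {(0, 0)}"

definition submonoid_Z2 :: "lattice set \<Rightarrow> bool" where
  "submonoid_Z2 C \<longleftrightarrow> (0, 0) \<in> C \<and> (\<forall>A\<in>C. \<forall>B\<in>C. A + B \<in> C)"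

text \<open>A word is a list of steps: \<^term>\<open>lists X\<close> is the free monoid on \<open>X\<close>, \<^const>\<open>sum_list\<close> is
  the endpoint map \<open>\<alpha>\<close>, and \<^term>\<open>take m w\<close> is the initial subword of length \<open>m\<close>.\<close>

definition constrained_words :: "lattice set \<Rightarrow> lattice set \<Rightarrow> lattice list set" where
  "constrained_words X C = {w \<in> lists X. \<forall>m \<le> length w. sum_list (take m w) \<in> C}"

definition reachable :: "lattice set \<Rightarrow> lattice set \<Rightarrow> lattice set" where
  "reachable X C = sum_list ` constrained_words X C"

definition words_to :: "lattice set \<Rightarrow> lattice set \<Rightarrow> lattice \<Rightarrow> lattice list set" where
  "words_to X C A = {w \<in> constrained_words X C. sum_list w = A}"

text \<open>The number \<open>\<pi>(A)\<close> of words ending at \<open>A\<close> is possibly infinite, so only the finiteness of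
  \<^term>\<open>words_to X C A\<close> is mentioned below; \<^const>\<open>card\<close> would be \<open>0\<close> on infinite sets.\<close>

definition FPP :: "lattice set \<Rightarrow> lattice set \<Rightarrow> bool" where
  "FPP X C \<longleftrightarrow> (\<forall>A \<in> reachable X C. finite (words_to X C A))"

definition IPP :: "lattice set \<Rightarrow> lattice set \<Rightarrow> bool" where
  "IPP X C \<longleftrightarrow> (\<forall>A \<in> reachable X C. infinite (words_to X C A))"

definition BPP :: "lattice set \<Rightarrow> lattice set \<Rightarrow> bool" where
  "BPP X C \<longleftrightarrow> (\<forall>A \<in> reachable X C. finite (length ` words_to X C A))"

subsection \<open>Half-planes, cones and the geometric conditions\<close>

definition to_plane :: "lattice \<Rightarrow> plane" where
  "to_plane A = (real_of_int (fst A), real_of_int (snd A))"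

text \<open>For a normal vector \<open>n \<noteq> 0\<close>, the sets \<open>pos_side n c\<close> and \<open>neg_side n c\<close> are the two opposite
  open half-planes bounded by \<open>line n c\<close>. Since \<open>neg_side n c = pos_side (- n) (- c)\<close>, every open
  half-plane is of the form \<open>pos_side n c\<close>.\<close>

definition line :: "plane \<Rightarrow> real \<Rightarrow> plane set" where
  "line n c = {p. n \<bullet> p = c}"

definition pos_side :: "plane \<Rightarrow> real \<Rightarrow> plane set" where
  "pos_side n c = {p. n \<bullet> p > c}"

definition neg_side :: "plane \<Rightarrow> real \<Rightarrow> plane set" where
  "neg_side n c = {p. n \<bullet> p < c}"

text \<open>\<^const>\<open>affine_parallel\<close> means being translates of each other, so that a line is parallel
  to itself.\<close>

definition plane_cone :: "plane set \<Rightarrow> plane \<Rightarrow> bool" where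
  "plane_cone K v \<longleftrightarrow> (\<exists>n c n' c'. n \<noteq> 0 \<and> n' \<noteq> 0 \<and>
     \<not> affine_parallel (line n c) (line n' c') \<and>
     line n c \<inter> line n' c' = {v} \<and>
     K = pos_side n c \<inter> pos_side n' c')"

definition LC :: "lattice set \<Rightarrow> bool" where
  "LC X \<longleftrightarrow> (\<exists>n c. n \<noteq> 0 \<and> (0, 0) \<in> line n c \<and> to_plane ` X \<subseteq> pos_side n c)"

definition SLC :: "lattice set \<Rightarrow> bool" where
  "SLC X \<longleftrightarrow> (\<exists>n c. n \<noteq> 0 \<and> to_plane ` X \<subseteq> pos_side n c \<and> (0, 0) \<in> neg_side n c)"

definition CC :: "lattice set \<Rightarrow> bool" where
  "CC X \<longleftrightarrow> (\<exists>K. plane_cone K (0, 0) \<and> to_plane ` X \<subseteq> K)"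

end

theory Submission
  imports Defs
begin

text \<open>A linear functional that is positive on \<open>X\<close> shows that no nonempty word ends at \<open>O\<close>; if it is
  bounded away from \<open>0\<close> on \<open>X\<close>, it bounds the lengths of the words ending at a given point; and if it
  dominates a norm on \<open>X\<close>, as the sum of the two functionals defining a cone does, it moreover bounds
  their letters. Conversely, a nonempty word ending at \<open>O\<close> may be iterated, since \<open>C\<close> is a monoid.
  The gap between LC and SLC is witnessed by the lattice points on one side of a line of irrational
  slope, which come arbitrarily close to the line.\<close>

subsection \<open>Algebraic form of the geometric conditions\<close>

lemma LC_iff: "LC X \<longleftrightarrow> (\<exists>n. n \<noteq> 0 \<and> (\<forall>A\<in>X. n \<bullet> to_plane A > 0))"
proof -
  have [simp]: "n \<bullet> (0, 0) = 0" for n :: plane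
    by (simp add: inner_prod_def)
  show ?thesis
    by (auto simp: LC_def line_def pos_side_def image_subset_iff)
qed

text \<open>That \<open>O\<close> lies on the negative side says exactly that \<open>c\<close> is
  positive: SLC is LC with a uniform gap.\<close>

lemma SLC_iff: "SLC X \<longleftrightarrow> (\<exists>n c. n \<noteq> 0 \<and> c > 0 \<and> (\<forall>A\<in>X. n \<bullet> to_plane A > c))"
proof -
  have [simp]: "n \<bullet> (0, 0) = 0" for n :: plane
    by (simp add: inner_prod_def)
  show ?thesis
    by (auto simp: SLC_def neg_side_def pos_side_def image_subset_iff)
qed

lemma lines_through_origin_meet:
  assumes "a * d \<noteq> b * (c::real)"
  shows "line (a, b) 0 \<inter> line (c, d) 0 = {(0, 0)}"
proof -
  have "p = (0, 0)" if "p \<in> line (a, b) 0 \<inter> line (c, d) 0" for p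
  proof -
    obtain x y where p: "p = (x, y)" by (cases p)
    have eqs: "a * x + b * y = 0" "c * x + d * y = 0"
      using that by (simp_all add: p line_def)
    \<comment> \<open>Cramer's rule; both right-hand sides vanish by \<open>eqs\<close>.\<close>
    have "(a * d - b * c) * x = d * (a * x + b * y) - b * (c * x + d * y)"
      "(a * d - b * c) * y = a * (c * x + d * y) - c * (a * x + b * y)"
      by (simp_all add: algebra_simps)
    then show ?thesis using assms unfolding eqs p by simp
  qed
  moreover have "(0, 0) \<in> line (a, b) 0 \<inter> line (c, d) 0"
    by (simp add: line_def)
  ultimately show ?thesis by blast
qed

text \<open>A vertex at the origin forces both offsets to be 0, and two lines through the origin are
  non-parallel iff the determinant of their normals is nonzero.\<close>

lemma CC_iff:
  "CC X \<longleftrightarrow> (\<exists>a b c d. a * d \<noteq> b * c \<and>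
     (\<forall>A\<in>X. (a, b) \<bullet> to_plane A > 0 \<and> (c, d) \<bullet> to_plane A > 0))"
proof
  assume "CC X"
  then obtain n c n' c' where
    meet: "line n c \<inter> line n' c' = {(0, 0)}" and
    X: "to_plane ` X \<subseteq> pos_side n c \<inter> pos_side n' c'" and n: "n \<noteq> 0"
    unfolding CC_def plane_cone_def by blast
  obtain a b where ab: "n = (a, b)" by (cases n)
  obtain e d where ed: "n' = (e, d)" by (cases n')
  have "(0, 0) \<in> line n c \<inter> line n' c'" using meet by simp
  then have c: "c = 0" "c' = 0" by (auto simp: line_def ab ed)
  have "a * d \<noteq> b * e"
  proof
    assume "a * d = b * e"
    then have "(- b, a) \<in> line n c \<inter> line n' c'"
      by (auto simp: line_def ab ed c algebra_simps)
    then have "(- b, a) \<in> {(0, 0)}" unfolding meet .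
    then show False using n by (simp add: ab zero_prod_def)
  qed
  moreover have "\<forall>A\<in>X. (a, b) \<bullet> to_plane A > 0 \<and> (e, d) \<bullet> to_plane A > 0"
    using X unfolding image_subset_iff pos_side_def c ab ed by blast
  ultimately show "\<exists>a b c d. a * d \<noteq> b * c \<and>
     (\<forall>A\<in>X. (a, b) \<bullet> to_plane A > 0 \<and> (c, d) \<bullet> to_plane A > 0)"
    by (intro exI conjI)
next
  assume "\<exists>a b c d. a * d \<noteq> b * c \<and>
     (\<forall>A\<in>X. (a, b) \<bullet> to_plane A > 0 \<and> (c, d) \<bullet> to_plane A > 0)"
  then obtain a b c d where det: "a * d \<noteq> b * c"
    and X: "\<forall>A\<in>X. (a, b) \<bullet> to_plane A > 0 \<and> (c, d) \<bullet> to_plane A > 0" by blast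
  have "\<not> affine_parallel (line (a, b) 0) (line (c, d) 0)"
  proof
    assume "affine_parallel (line (a, b) 0) (line (c, d) 0)"
    then obtain v where v: "line (c, d) 0 = (\<lambda>x. v + x) ` line (a, b) 0"
      unfolding affine_parallel_def by blast
    \<comment> \<open>The translates of these two points differ by the direction
      \<open>(- b, a)\<close> of the first line, which is therefore orthogonal to
      \<open>(c, d)\<close>.\<close>
    have "(0, 0) \<in> line (a, b) 0" "(- b, a) \<in> line (a, b) 0"
      by (auto simp: line_def)
    then have "v + (0, 0) \<in> line (c, d) 0" "v + (- b, a) \<in> line (c, d) 0"
      unfolding v by blast+
    then have "(c, d) \<bullet> (- b, a) = 0"
      by (simp add: line_def inner_add_right)
    then show False using det by (simp add: algebra_simps)
  qed
  moreover have "line (a, b) 0 \<inter> line (c, d) 0 = {(0, 0)}"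
    using lines_through_origin_meet[OF det] .
  moreover have "(a, b) \<noteq> 0" "(c, d) \<noteq> 0"
    using det by (auto simp: zero_prod_def)
  ultimately have "plane_cone (pos_side (a, b) 0 \<inter> pos_side (c, d) 0) (0, 0)"
    unfolding plane_cone_def by blast
  then show "CC X"
    unfolding CC_def using X
    by (intro exI[of _ "pos_side (a, b) 0 \<inter> pos_side (c, d) 0"]) (auto simp: pos_side_def)
qed

text \<open>Cramer's rule recovers \<open>x\<close> and \<open>y\<close> from the two functionals;
  as both are nonnegative, their sum dominates the 1-norm up to a constant.\<close>

lemma abs_coordinates_le:
  fixes a b c d x y :: real
  assumes s: "a * x + b * y \<ge> 0" and t: "c * x + d * y \<ge> 0"
  shows "\<bar>a * d - b * c\<bar> * (\<bar>x\<bar> + \<bar>y\<bar>)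
    \<le> (\<bar>a\<bar> + \<bar>b\<bar> + \<bar>c\<bar> + \<bar>d\<bar>) * ((a + c) * x + (b + d) * y)"
proof -
  define s t where st: "s = a * x + b * y" "t = c * x + d * y"
  have "(a * d - b * c) * x = d * s - b * t" "(a * d - b * c) * y = a * t - c * s"
    by (simp_all add: st algebra_simps)
  then have "\<bar>a * d - b * c\<bar> * \<bar>x\<bar> = \<bar>d * s - b * t\<bar>" "\<bar>a * d - b * c\<bar> * \<bar>y\<bar> = \<bar>a * t - c * s\<bar>"
    by (simp_all only: flip: abs_mult)
  moreover have "\<bar>d * s\<bar> = \<bar>d\<bar> * s" "\<bar>b * t\<bar> = \<bar>b\<bar> * t" "\<bar>a * t\<bar> = \<bar>a\<bar> * t" "\<bar>c * s\<bar> = \<bar>c\<bar> * s"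
    using assms by (simp_all add: st abs_mult)
  ultimately have "\<bar>a * d - b * c\<bar> * \<bar>x\<bar> \<le> \<bar>d\<bar> * s + \<bar>b\<bar> * t" "\<bar>a * d - b * c\<bar> * \<bar>y\<bar> \<le> \<bar>a\<bar> * t + \<bar>c\<bar> * s"
    using abs_triangle_ineq4[of "d * s" "b * t"] abs_triangle_ineq4[of "a * t" "c * s"] by linarith+
  \<comment> \<open>The four products missing from the bounds complete them to a multiple of
    \<open>s + t\<close>.\<close>
  moreover have "0 \<le> \<bar>b\<bar> * s" "0 \<le> \<bar>d\<bar> * t" "0 \<le> \<bar>a\<bar> * s" "0 \<le> \<bar>c\<bar> * t"
    using assms by (simp_all add: st)
  ultimately have "\<bar>a * d - b * c\<bar> * (\<bar>x\<bar> + \<bar>y\<bar>) \<le> (\<bar>a\<bar> + \<bar>b\<bar> + \<bar>c\<bar> + \<bar>d\<bar>) * (s + t)"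
    by (simp add: algebra_simps)
  also have "s + t = (a + c) * x + (b + d) * y"
    by (simp add: st algebra_simps)
  finally show ?thesis .
qed

lemma CC_coercive:
  assumes "CC X"
  obtains n \<delta> where "n \<noteq> 0" "\<delta> > 0"
    "\<And>A. A \<in> X \<Longrightarrow> \<delta> * (\<bar>of_int (fst A)\<bar> + \<bar>of_int (snd A)\<bar>) \<le> n \<bullet> to_plane A"
proof -
  obtain a b c d where det: "a * d \<noteq> b * c"
    and X: "\<And>A. A \<in> X \<Longrightarrow> (a, b) \<bullet> to_plane A > 0 \<and> (c, d) \<bullet> to_plane A > 0"
    using assms unfolding CC_iff by blast
  define M where "M = \<bar>a\<bar> + \<bar>b\<bar> + \<bar>c\<bar> + \<bar>d\<bar>"
  have "a \<noteq> 0 \<or> b \<noteq> 0" using det by auto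
  then have M: "M > 0" by (auto simp: M_def)
  show ?thesis
  proof
    show "(a + c, b + d) \<noteq> 0"
    proof
      assume "(a + c, b + d) = 0"
      then have "c = - a" "d = - b" by (auto simp: zero_prod_def)
      then show False using det by simp
    qed
    show "\<bar>a * d - b * c\<bar> / M > 0"
      using M det by simp
    show "\<bar>a * d - b * c\<bar> / M * (\<bar>of_int (fst A)\<bar> + \<bar>of_int (snd A)\<bar>) \<le> (a + c, b + d) \<bullet> to_plane A"
      if "A \<in> X" for A
      using abs_coordinates_le[of a "of_int (fst A)" b "of_int (snd A)" c d] X[OF that] M
      by (simp add: to_plane_def M_def[symmetric] divide_le_eq mult.commute)
  qed
qed

subsection \<open>Linear functionals along words\<close>

lemma inner_to_plane_sum_list:
  "n \<bullet> to_plane (sum_list w) = (\<Sum>A\<leftarrow>w. n \<bullet> to_plane A)"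
proof (induction w)
  case Nil
  show ?case by (cases n) (simp add: to_plane_def zero_prod_def)
next
  case (Cons A w)
  then show ?case by (cases n) (simp add: to_plane_def algebra_simps)
qed

lemma length_mult_le_sum_list:
  fixes f :: "'a \<Rightarrow> real" and c :: real
  assumes "\<And>x. x \<in> set xs \<Longrightarrow> c \<le> f x"
  shows "length xs * c \<le> sum_list (map f xs)"
  using assms
proof (induction xs)
  case (Cons x xs)
  then have "length xs * c \<le> sum_list (map f xs)" "c \<le> f x" by simp_all
  then show ?case by (simp add: algebra_simps)
qed simp

lemma member_le_sum_list_nonneg:
  fixes f :: "'a \<Rightarrow> real"
  assumes "\<And>x. x \<in> set xs \<Longrightarrow> 0 \<le> f x" "x \<in> set xs"
  shows "f x \<le> sum_list (map f xs)"
  using assms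
proof (induction xs)
  case (Cons y ys)
  have "0 \<le> sum_list (map f ys)"
    using Cons.prems by (intro sum_list_nonneg) auto
  then show ?case
    using Cons by (cases "x = y") (force simp: add_increasing add_increasing2)+
qed simp

lemma words_to_D:
  assumes "w \<in> words_to X C A"
  shows "set w \<subseteq> X" "sum_list w = A"
  using assms by (auto simp: words_to_def constrained_words_def)

text \<open>The value at the endpoint is the sum of the values at the letters, and no summand
  exceeds a sum of nonnegative terms.\<close>

lemma inner_letter_le:
  assumes "w \<in> words_to X C A" "B \<in> set w" "\<And>B. B \<in> X \<Longrightarrow> 0 \<le> n \<bullet> to_plane B"
  shows "n \<bullet> to_plane B \<le> n \<bullet> to_plane A"
proof -
  have "n \<bullet> to_plane B \<le> (\<Sum>B\<leftarrow>w. n \<bullet> to_plane B)"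
    using words_to_D(1)[OF assms(1)] assms(2,3)
    by (intro member_le_sum_list_nonneg[of w "\<lambda>B. n \<bullet> to_plane B"]) blast+
  then show ?thesis
    using words_to_D(2)[OF assms(1)] by (simp flip: inner_to_plane_sum_list)
qed

lemma Nil_in_words_to: "submonoid_Z2 C \<Longrightarrow> [] \<in> words_to X C 0"
  by (simp add: words_to_def constrained_words_def submonoid_Z2_def zero_prod_def)

lemma zero_reachable: "submonoid_Z2 C \<Longrightarrow> 0 \<in> reachable X C"
  unfolding reachable_def using Nil_in_words_to[of C X]
  by (intro image_eqI[of _ _ "[]"]) (simp_all add: words_to_def)

text \<open>A prefix that reaches into \<open>v\<close> ends at the sum of \<open>A\<close> and the
  endpoint of a prefix of \<open>v\<close>, and \<open>C\<close> is closed under addition.\<close>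

lemma append_in_words_to:
  assumes C: "submonoid_Z2 C" and u: "u \<in> words_to X C A" and v: "v \<in> words_to X C B"
  shows "u @ v \<in> words_to X C (A + B)"
proof -
  have "sum_list (take m (u @ v)) \<in> C" if "m \<le> length (u @ v)" for m
  proof (cases "m \<le> length u")
    case True
    then show ?thesis using u by (auto simp: words_to_def constrained_words_def)
  next
    case False
    then have "sum_list u \<in> C" "sum_list (take (m - length u) v) \<in> C"
      using u v that by (auto simp: words_to_def constrained_words_def)
    then show ?thesis using False C by (auto simp: submonoid_Z2_def)
  qed
  then show ?thesis using u v by (auto simp: words_to_def constrained_words_def)
qed

text \<open>The hypothesis \<open>step\<close> asks only that appending \<open>w\<close> be harmless
  at \<open>A\<close>, so \<open>w\<close> need not be admissible when started at
  \<open>O\<close>.\<close>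

lemma infinite_lengths_pumping:
  assumes u: "u \<in> words_to X C A" and "w \<noteq> []"
    and step: "\<And>v. v \<in> words_to X C A \<Longrightarrow> v @ w \<in> words_to X C A"
  shows "infinite (length ` words_to X C A)"
proof -
  have ex: "\<exists>v\<in>words_to X C A. k \<le> length v" for k
  proof (induction k)
    case 0
    then show ?case using u by blast
  next
    case (Suc k)
    then obtain v where v: "v \<in> words_to X C A" "k \<le> length v" by blast
    have "0 < length w" using \<open>w \<noteq> []\<close> by simp
    then have "Suc k \<le> length (v @ w)" using v(2) unfolding length_append by linarith
    then show ?case using step[OF v(1)] by blast
  qed
  then show ?thesis
    unfolding infinite_nat_iff_unbounded_le by blast
qed

subsection \<open>The implications\<close>

text \<open>A nonzero lattice point has 1-norm at least 1, so the coercive functional is at least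
  \<delta> on \<open>X\<close>.\<close>

lemma CC_imp_SLC:
  assumes "step_set X" "CC X"
  shows "SLC X"
proof -
  obtain n \<delta> where n: "n \<noteq> 0" and \<delta>: "\<delta> > 0" and
    le: "\<And>A. A \<in> X \<Longrightarrow> \<delta> * (\<bar>of_int (fst A)\<bar> + \<bar>of_int (snd A)\<bar>) \<le> n \<bullet> to_plane A"
    using CC_coercive[OF assms(2)] by blast
  have "\<delta> / 2 < n \<bullet> to_plane A" if "A \<in> X" for A
  proof -
    have "fst A \<noteq> 0 \<or> snd A \<noteq> 0"
      using assms(1) that by (cases A) (auto simp: step_set_def)
    then have "1 \<le> \<bar>fst A\<bar> + \<bar>snd A\<bar>" by linarith
    then have "1 \<le> real_of_int (\<bar>fst A\<bar> + \<bar>snd A\<bar>)" by (simp only: of_int_1_le_iff)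
    then have "\<delta> * 1 \<le> \<delta> * (\<bar>of_int (fst A)\<bar> + \<bar>of_int (snd A)\<bar>)"
      using \<delta> by (intro mult_left_mono) auto
    then show ?thesis using le[OF that] \<delta> by linarith
  qed
  then show ?thesis
    unfolding SLC_iff using n \<delta> by (intro exI[of _ n] exI[of _ "\<delta> / 2"]) auto
qed

lemma SLC_imp_LC: "SLC X \<Longrightarrow> LC X"
  unfolding SLC_iff LC_iff by (meson less_trans)

lemma FPP_imp_BPP: "FPP X C \<Longrightarrow> BPP X C"
  by (simp add: FPP_def BPP_def)

text \<open>IPP at \<open>O\<close> yields a nonempty closed word, whose powers are closed words of
  unbounded length.\<close>

lemma BPP_imp_not_IPP:
  assumes C: "submonoid_Z2 C" and "BPP X C"
  shows "\<not> IPP X C"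
proof
  assume "IPP X C"
  then have "infinite (words_to X C 0)"
    using zero_reachable[OF C] by (simp add: IPP_def)
  then obtain w where w: "w \<in> words_to X C 0" "w \<noteq> []"
    by (metis finite.emptyI finite_insert finite_subset singletonI subsetI)
  have "infinite (length ` words_to X C 0)"
    using infinite_lengths_pumping[OF w(1) w(2)] append_in_words_to[OF C _ w(1)]
    by (metis add_0)
  then show False
    using \<open>BPP X C\<close> zero_reachable[OF C] by (simp add: BPP_def)
qed

text \<open>Each letter contributes more than \<open>c\<close> to the value of the functional at
  \<open>A\<close>, which bounds the number of letters.\<close>

lemma SLC_imp_BPP:
  assumes "SLC X"
  shows "BPP X C"
proof -
  obtain n c where c: "c > 0" and gt: "\<And>A. A \<in> X \<Longrightarrow> n \<bullet> to_plane A > c"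
    using assms unfolding SLC_iff by blast
  have "finite (length ` words_to X C A)" for A
  proof -
    have "length w \<le> nat \<lfloor>n \<bullet> to_plane A / c\<rfloor>" if "w \<in> words_to X C A" for w
    proof -
      have "length w * c \<le> (\<Sum>B\<leftarrow>w. n \<bullet> to_plane B)"
        using words_to_D(1)[OF that] gt by (intro length_mult_le_sum_list) (meson less_imp_le subsetD)
      also have "\<dots> = n \<bullet> to_plane A"
        using words_to_D(2)[OF that] by (simp flip: inner_to_plane_sum_list)
      finally have "length w * c \<le> n \<bullet> to_plane A" .
      then have "real (length w) \<le> n \<bullet> to_plane A / c"
        using c by (simp add: pos_le_divide_eq)
      then show ?thesis by linarith
    qed
    then have "length ` words_to X C A \<subseteq> {..nat \<lfloor>n \<bullet> to_plane A / c\<rfloor>}" by auto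
    then show ?thesis by (rule finite_subset) simp
  qed
  then show ?thesis by (simp add: BPP_def)
qed

lemma finite_words_to:
  assumes "finite Y" "finite (length ` words_to X C A)"
    and "\<And>w. w \<in> words_to X C A \<Longrightarrow> set w \<subseteq> Y"
  shows "finite (words_to X C A)"
proof -
  obtain N where "\<forall>k \<in> length ` words_to X C A. k \<le> N"
    using assms(2) by (auto simp: finite_nat_set_iff_bounded_le)
  then have "words_to X C A \<subseteq> {w. set w \<subseteq> Y \<and> length w \<le> N}"
    using assms(3) by auto
  then show ?thesis
    using finite_lists_length_le[OF assms(1)] finite_subset by blast
qed

text \<open>The coercive functional confines the letters of all words ending at \<open>A\<close> to
  one finite box, and SLC bounds their lengths.\<close>

lemma CC_imp_FPP:
  assumes "step_set X" "CC X"
  shows "FPP X C"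
  unfolding FPP_def
proof
  fix A assume A: "A \<in> reachable X C"
  obtain n \<delta> where \<delta>: "\<delta> > 0" and
    le: "\<And>B. B \<in> X \<Longrightarrow> \<delta> * (\<bar>of_int (fst B)\<bar> + \<bar>of_int (snd B)\<bar>) \<le> n \<bullet> to_plane B"
    using CC_coercive[OF assms(2)] by blast
  define N where "N = \<lfloor>n \<bullet> to_plane A / \<delta>\<rfloor>"
  have nonneg: "0 \<le> n \<bullet> to_plane B" if "B \<in> X" for B
    using le[OF that] \<delta> by (smt (verit) mult_nonneg_nonneg abs_ge_zero)
  have "B \<in> {- N..N} \<times> {- N..N}" if "w \<in> words_to X C A" "B \<in> set w" for w B
  proof -
    have "n \<bullet> to_plane B \<le> n \<bullet> to_plane A"
      using inner_letter_le[OF that] nonneg by blast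
    moreover have "B \<in> X" using words_to_D(1)[OF that(1)] that(2) by blast
    ultimately have "\<delta> * (\<bar>of_int (fst B)\<bar> + \<bar>of_int (snd B)\<bar>) \<le> n \<bullet> to_plane A"
      using le by fastforce
    then have "real_of_int (\<bar>fst B\<bar> + \<bar>snd B\<bar>) \<le> n \<bullet> to_plane A / \<delta>"
      using \<delta> by (simp add: pos_le_divide_eq mult.commute)
    then have "\<bar>fst B\<bar> + \<bar>snd B\<bar> \<le> N"
      unfolding N_def by (simp only: le_floor_iff)
    then show ?thesis by (cases B) auto
  qed
  moreover have "finite (length ` words_to X C A)"
    using SLC_imp_BPP[OF CC_imp_SLC[OF assms]] A by (simp add: BPP_def)
  ultimately show "finite (words_to X C A)"
    by (intro finite_words_to[of "{- N..N} \<times> {- N..N}"]) auto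
qed

text \<open>A letter of a word ending at \<open>O\<close> would have a positive value bounded by the
  value 0 at \<open>O\<close>, so only the empty word ends there.\<close>

lemma LC_imp_not_IPP:
  assumes C: "submonoid_Z2 C" and "LC X"
  shows "\<not> IPP X C"
proof -
  obtain n where pos: "\<And>A. A \<in> X \<Longrightarrow> n \<bullet> to_plane A > 0"
    using assms(2) unfolding LC_iff by blast
  have "w = []" if "w \<in> words_to X C 0" for w
  proof (rule ccontr)
    assume "w \<noteq> []"
    then obtain B where B: "B \<in> set w" by (cases w) auto
    have "n \<bullet> to_plane B \<le> n \<bullet> to_plane 0"
      using inner_letter_le[OF that B] pos less_imp_le by blast
    also have "\<dots> = 0"
      using inner_to_plane_sum_list[of n "[]"] by simp
    finally show False
      using pos[of B] words_to_D(1)[OF that] B by fastforce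
  qed
  then have "words_to X C 0 \<subseteq> {[]}" by blast
  then have "finite (words_to X C 0)" by (rule finite_subset) simp
  then show ?thesis using zero_reachable[OF C] by (auto simp: IPP_def)
qed

subsection \<open>Converses for finite step sets\<close>

lemma finite_LC_imp_SLC:
  assumes "finite X" "LC X"
  shows "SLC X"
proof -
  obtain n where n: "n \<noteq> 0" and pos: "\<And>A. A \<in> X \<Longrightarrow> n \<bullet> to_plane A > 0"
    using assms(2) unfolding LC_iff by blast
  \<comment> \<open>Inserting 1 keeps the minimum meaningful and positive when \<open>X\<close> is
    empty.\<close>
  define m where "m = Min (insert 1 ((\<lambda>A. n \<bullet> to_plane A) ` X))"
  have m: "m > 0" "\<And>A. A \<in> X \<Longrightarrow> m \<le> n \<bullet> to_plane A"
    unfolding m_def using assms(1) pos by auto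
  then show ?thesis
    unfolding SLC_iff using n by (intro exI[of _ n] exI[of _ "m / 2"]) force
qed

text \<open>The normal vector is tilted to either side by an angle too small to reach any of the finitely
  many steps.\<close>

lemma finite_SLC_imp_CC:
  assumes "finite X" "SLC X"
  shows "CC X"
proof -
  obtain n c where n: "n \<noteq> 0" and c: "c > 0" and gt: "\<And>A. A \<in> X \<Longrightarrow> n \<bullet> to_plane A > c"
    using assms(2) unfolding SLC_iff by blast
  obtain a b where ab: "n = (a, b)" by (cases n)
  define M where "M = Max (insert 1 ((\<lambda>A. \<bar>(- b, a) \<bullet> to_plane A\<bar>) ` X))"
  have M: "M > 0" "\<And>A. A \<in> X \<Longrightarrow> \<bar>(- b, a) \<bullet> to_plane A\<bar> \<le> M"
    unfolding M_def using assms(1) by (auto simp: Max_gr_iff)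
  \<comment> \<open>With this tilt, \<open>e * (- b, a)\<close> changes the value at a step by at
    most \<open>c\<close>, so both \<open>n + e * (- b, a)\<close> and
    \<open>n - e * (- b, a)\<close> stay positive on \<open>X\<close>.\<close>
  define e where "e = c / M"
  have e: "e > 0" using c M by (simp add: e_def)
  have small: "\<bar>e * ((- b, a) \<bullet> to_plane A)\<bar> < n \<bullet> to_plane A" if "A \<in> X" for A
  proof -
    have "\<bar>e * ((- b, a) \<bullet> to_plane A)\<bar> \<le> e * M"
      using M(2)[OF that] e by (simp add: abs_mult)
    also have "\<dots> = c" using M(1) by (simp add: e_def)
    finally show ?thesis using gt[OF that] by linarith
  qed
  have "(a - e * b) * (b - e * a) - (b + e * a) * (a + e * b) = - 2 * e * (a\<^sup>2 + b\<^sup>2)"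
    by (simp add: algebra_simps power2_eq_square)
  moreover have "a\<^sup>2 + b\<^sup>2 \<noteq> 0"
    using n by (auto simp: ab zero_prod_def)
  ultimately have "(a - e * b) * (b - e * a) \<noteq> (b + e * a) * (a + e * b)"
    using e by auto
  moreover have "(a - e * b, b + e * a) \<bullet> to_plane A > 0 \<and> (a + e * b, b - e * a) \<bullet> to_plane A > 0"
    if "A \<in> X" for A
    using small[OF that] by (simp add: ab to_plane_def algebra_simps abs_less_iff)
  ultimately show ?thesis unfolding CC_iff by blast
qed

lemma finite_BPP_imp_FPP:
  assumes "finite X" "BPP X C"
  shows "FPP X C"
  unfolding FPP_def
proof
  fix A assume "A \<in> reachable X C"
  then have "finite (length ` words_to X C A)" using assms(2) by (simp add: BPP_def)
  then show "finite (words_to X C A)"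
    using finite_words_to[OF assms(1)] words_to_D(1) by blast
qed

subsection \<open>Finite counterexamples\<close>

lemma submonoid_zero: "submonoid_Z2 {(0, 0)}"
  by (simp add: submonoid_Z2_def)

text \<open>Steps are nonzero, so the first step already leaves the origin and only the empty word
  is admissible, whatever the geometry of \<open>X\<close>.\<close>

lemma FPP_zero:
  assumes "step_set X"
  shows "FPP X {(0, 0)}"
proof -
  have "w = []" if "w \<in> constrained_words X {(0, 0)}" for w
  proof (rule ccontr)
    assume "w \<noteq> []"
    then obtain A v where w: "w = A # v" by (cases w) auto
    have "sum_list (take 1 w) = (0, 0)"
      using that by (auto simp: constrained_words_def w)
    then have "A = (0, 0)" by (simp add: w)
    then show False
      using that assms by (auto simp: constrained_words_def w step_set_def)
  qed
  then have "words_to X {(0, 0)} A \<subseteq> {[]}" for A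
    by (auto simp: words_to_def)
  then show ?thesis
    unfolding FPP_def by (meson finite.emptyI finite_insert finite_subset)
qed

lemma not_LC_horizontal: "\<not> LC {(1, 0), (- 1, 0)}"
  unfolding LC_iff by (auto simp: to_plane_def)

text \<open>A path must start upwards and can never come down again, so only the empty word ends at
  \<open>O\<close>; above the axis, horizontal moves are free and give loops at
  \<open>(0, 1)\<close>.\<close>

lemma finite_not_IPP_not_BPP:
  defines "X \<equiv> {(0, 1), (1, 0), (- 1, 0)}"
    and "C \<equiv> insert (0, 0) {A. snd A \<ge> 1}"
  shows "step_set X" "finite X" "submonoid_Z2 C" "\<not> IPP X C" "\<not> BPP X C"
proof -
  show "step_set X" "finite X" by (auto simp: X_def step_set_def)
  show C: "submonoid_Z2 C" by (auto simp: C_def submonoid_Z2_def zero_prod_def)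
  have snd_mono: "snd (sum_list v) \<ge> 0" if "set v \<subseteq> X" for v
    using that by (induction v) (auto simp: X_def)
  have "w = []" if w: "w \<in> words_to X C 0" for w
  proof (rule ccontr)
    assume "w \<noteq> []"
    then obtain A v where Av: "w = A # v" by (cases w) auto
    have "sum_list (take 1 w) \<in> C" "A \<in> X"
      using w by (auto simp: words_to_def constrained_words_def Av)
    then have "snd A = 1" by (auto simp: Av X_def C_def)
    moreover have "snd (sum_list v) \<ge> 0"
      using words_to_D(1)[OF w] by (intro snd_mono) (auto simp: Av)
    ultimately have "snd (sum_list w) > 0" by (simp add: Av)
    then show False using words_to_D(2)[OF w] by simp
  qed
  then have "words_to X C 0 \<subseteq> {[]}" by blast
  then have "finite (words_to X C 0)" by (rule finite_subset) simp
  then show "\<not> IPP X C" using zero_reachable[OF C] by (auto simp: IPP_def)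
  have up: "[(0, 1)] \<in> words_to X C (0, 1)"
    by (auto simp: words_to_def constrained_words_def X_def C_def le_Suc_eq zero_prod_def)
  have loop: "v @ [(1, 0), (- 1, 0)] \<in> words_to X C (0, 1)" if v: "v \<in> words_to X C (0, 1)" for v
  proof -
    have "sum_list (take m (v @ [(1, 0), (- 1, 0)])) \<in> C"
      if "m \<le> length (v @ [(1, 0), (- 1, 0 :: int)])" for m
    proof -
      \<comment> \<open>The only new intermediate point is \<open>(1, 1)\<close>; then the path is
        back at \<open>(0, 1)\<close>.\<close>
      consider "m \<le> length v" | "m = length v + 1" | "m = length v + 2"
        using \<open>m \<le> _\<close> by fastforce
      then show ?thesis
        using v by cases (auto simp: words_to_def constrained_words_def C_def)
    qed
    then show ?thesis
      using v by (auto simp: words_to_def constrained_words_def X_def)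
  qed
  have "infinite (length ` words_to X C (0, 1))"
    using infinite_lengths_pumping[OF up _ loop] by simp
  moreover have "(0, 1) \<in> reachable X C"
    using up by (force simp: reachable_def words_to_def)
  ultimately show "\<not> BPP X C" by (auto simp: BPP_def)
qed

subsection \<open>Infinite counterexamples\<close>

text \<open>A nonzero slope makes the multiples tend to minus infinity in one direction; an integer
  just past the crossing point \<open>K / e\<close> violates the bound.\<close>

lemma real_bounded_below_int_multiples:
  fixes e K :: real
  assumes "\<And>k::int. K \<le> e * of_int k"
  shows "e = 0"
proof (rule ccontr)
  assume "e \<noteq> 0"
  define k where "k = \<lfloor>K / e\<rfloor>"
  have k: "of_int k \<le> K / e" "K / e < of_int k + 1" unfolding k_def by linarith+
  show False
  proof (cases "e > 0")
    case True
    then have "e * of_int (k - 1) < e * (K / e)" using k by (intro mult_strict_left_mono) auto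
    then show False using assms[of "k - 1"] \<open>e \<noteq> 0\<close> by simp
  next
    case False
    then have "e * of_int (k + 1) < e * (K / e)"
      using k \<open>e \<noteq> 0\<close> by (intro mult_strict_left_mono_neg) auto
    then show False using assms[of "k + 1"] \<open>e \<noteq> 0\<close> by simp
  qed
qed

lemma SLC_vertical: "SLC (range (Pair 1))"
  unfolding SLC_iff
  by (intro exI[of _ "(1, 0)"] exI[of _ "1 / 2"]) (auto simp: to_plane_def zero_prod_def)

text \<open>Positivity at \<open>(1, k)\<close> for all integers \<open>k\<close> makes both normals
  horizontal, hence parallel.\<close>

lemma not_CC_vertical: "\<not> CC (range (Pair 1))"
proof
  assume "CC (range (Pair 1))"
  then obtain a b c d :: real where det: "a * d \<noteq> b * c"
    and pos: "\<And>k::int. a + b * of_int k > 0 \<and> c + d * of_int k > 0"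
    by (auto simp: CC_iff to_plane_def)
  have "b = 0" "d = 0"
    using pos real_bounded_below_int_multiples[of "- a" b]
      real_bounded_below_int_multiples[of "- c" d] by (smt (verit))+
  then show False using det by simp
qed

text \<open>The point \<open>(2, 0)\<close> is the sum of \<open>(1, k)\<close> and
  \<open>(1, - k)\<close> for every \<open>k\<close>: infinitely many words, all of length
  two.\<close>

lemma not_FPP_vertical: "\<not> FPP (range (Pair 1)) UNIV"
proof
  assume fpp: "FPP (range (Pair 1)) UNIV"
  define w :: "int \<Rightarrow> lattice list" where "w k = [(1, k), (1, - k)]" for k
  have w: "range w \<subseteq> words_to (range (Pair 1)) UNIV (2, 0)"
    by (auto simp: w_def words_to_def constrained_words_def)
  then have "(2, 0) \<in> reachable (range (Pair 1)) UNIV"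
    by (force simp: reachable_def words_to_def)
  with fpp w have "finite (range w)" by (auto simp: FPP_def intro: finite_subset)
  moreover have "inj w" by (auto simp: w_def inj_def)
  ultimately show False
    using finite_imageD infinite_UNIV_int by blast
qed

text \<open>The integers extended by \<open>sqrt 2\<close> form a ring. The powers supply lattice
  points strictly on one side of the irrational line that approach it.\<close>

lemma sqrt2_power_in_lattice: "\<exists>a b. of_int a + of_int b * sqrt 2 = (sqrt 2 - 1) ^ k"
proof (induction k)
  case 0
  show ?case by (intro exI[of _ 1] exI[of _ 0]) simp
next
  case (Suc k)
  then obtain a b where "of_int a + of_int b * sqrt 2 = (sqrt 2 - 1) ^ k" by blast
  then have "of_int (2 * b - a) + of_int (a - b) * sqrt 2 = (sqrt 2 - 1) ^ Suc k"
    by (simp add: algebra_simps flip: \<open>_ = (sqrt 2 - 1) ^ k\<close>)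
  then show ?case by blast
qed

lemma LC_irrational: "LC {A. of_int (fst A) + of_int (snd A) * sqrt 2 > 0}"
  unfolding LC_iff
  by (intro exI[of _ "(1, sqrt 2)"]) (auto simp: to_plane_def zero_prod_def mult.commute)

lemma not_SLC_irrational: "\<not> SLC {A. of_int (fst A) + of_int (snd A) * sqrt 2 > 0}"
proof
  assume "SLC {A. of_int (fst A) + of_int (snd A) * sqrt 2 > 0}"
  then obtain p q c :: real where c: "c > 0"
    and gt: "\<And>a b. of_int a + of_int b * sqrt 2 > 0 \<Longrightarrow> p * of_int a + q * of_int b > c"
    by (auto simp: SLC_iff to_plane_def)
  \<comment> \<open>Points at bounded distance from the line \<open>x + sqrt 2 * y = 0\<close>, arbitrarily far out in both
    directions, force \<open>(p, q)\<close> to be normal to that line.\<close>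
  have "- (2 * \<bar>p\<bar>) \<le> (q - p * sqrt 2) * of_int b" for b
  proof -
    \<comment> \<open>This makes \<open>t\<close> equal to 1 plus the fractional part of
      \<open>of_int b * sqrt 2\<close>.\<close>
    define a where "a = 1 - \<lfloor>of_int b * sqrt 2\<rfloor>"
    define t where "t = of_int a + of_int b * sqrt 2"
    have t: "0 < t" "t \<le> 2" unfolding t_def a_def by linarith+
    have "0 < p * of_int a + q * of_int b"
      using gt[of a b] t c by (simp add: t_def)
    also have "\<dots> = p * t + (q - p * sqrt 2) * of_int b"
      by (simp add: t_def algebra_simps)
    also have "p * t \<le> \<bar>p\<bar> * 2"
      using t by (intro mult_mono) auto
    finally show ?thesis by simp
  qed
  then have q: "q = p * sqrt 2"
    using real_bounded_below_int_multiples by fastforce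
  \<comment> \<open>The functional is now \<open>p\<close> times the one defining the half-plane,
    and the latter takes arbitrarily small positive values, which leaves no room for the gap
    \<open>c\<close>.\<close>
  have "c \<le> p * (sqrt 2 - 1) ^ k" for k
  proof -
    obtain a b where ab: "of_int a + of_int b * sqrt 2 = (sqrt 2 - 1) ^ k"
      using sqrt2_power_in_lattice by blast
    then have "of_int a + of_int b * sqrt 2 > 0" by simp
    then show ?thesis
      using gt[of a b] by (simp add: q algebra_simps flip: ab)
  qed
  moreover have "(\<lambda>k. p * (sqrt 2 - 1) ^ k) \<longlonglongrightarrow> p * 0"
    using sqrt2_less_2 by (intro tendsto_mult_left LIMSEQ_power_zero) auto
  ultimately have "c \<le> p * 0"
    by (intro LIMSEQ_le_const) auto
  then show False using c by simp
qed

theorem theorem3p6: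
  shows
    "(\<comment> \<open>(i)\<close>
      \<forall>X C. step_set X \<and> submonoid_Z2 C \<longrightarrow>
        (CC X \<longrightarrow> SLC X) \<and>
        (SLC X \<longrightarrow> LC X) \<and>
        (FPP X C \<longrightarrow> BPP X C) \<and>
        (BPP X C \<longrightarrow> \<not> IPP X C) \<and>
        (CC X \<longrightarrow> FPP X C) \<and>
        (SLC X \<longrightarrow> BPP X C) \<and>
        (LC X \<longrightarrow> \<not> IPP X C)) \<and>
     (\<comment> \<open>(ii)\<close>
      (\<forall>X C. step_set X \<and> finite X \<and> submonoid_Z2 C \<longrightarrow>
        (SLC X \<longrightarrow> CC X) \<and>
        (LC X \<longrightarrow> SLC X) \<and>
        (BPP X C \<longrightarrow> FPP X C)) \<and>
      (\<exists>X C. step_set X \<and> finite X \<and> submonoid_Z2 C \<and> \<not> (\<not> IPP X C \<longrightarrow> BPP X C)) \<and>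
      (\<exists>X C. step_set X \<and> finite X \<and> submonoid_Z2 C \<and> \<not> (FPP X C \<longrightarrow> CC X)) \<and>
      (\<exists>X C. step_set X \<and> finite X \<and> submonoid_Z2 C \<and> \<not> (BPP X C \<longrightarrow> SLC X)) \<and>
      (\<exists>X C. step_set X \<and> finite X \<and> submonoid_Z2 C \<and> \<not> (\<not> IPP X C \<longrightarrow> LC X))) \<and>
     (\<comment> \<open>(iii)\<close>
      (\<exists>X C. step_set X \<and> submonoid_Z2 C \<and> \<not> (SLC X \<longrightarrow> CC X)) \<and>
      (\<exists>X C. step_set X \<and> submonoid_Z2 C \<and> \<not> (LC X \<longrightarrow> SLC X)) \<and>
      (\<exists>X C. step_set X \<and> submonoid_Z2 C \<and> \<not> (BPP X C \<longrightarrow> FPP X C)) \<and>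
      (\<exists>X C. step_set X \<and> submonoid_Z2 C \<and> \<not> (\<not> IPP X C \<longrightarrow> BPP X C)) \<and>
      (\<exists>X C. step_set X \<and> submonoid_Z2 C \<and> \<not> (FPP X C \<longrightarrow> CC X)) \<and>
      (\<exists>X C. step_set X \<and> submonoid_Z2 C \<and> \<not> (BPP X C \<longrightarrow> SLC X)) \<and>
      (\<exists>X C. step_set X \<and> submonoid_Z2 C \<and> \<not> (\<not> IPP X C \<longrightarrow> LC X)))"
proof -
  let ?H = "{(1, 0), (- 1, 0)} :: lattice set"
  have H: "step_set ?H" "finite ?H" by (auto simp: step_set_def)
  have vert: "step_set (range (Pair 1))" by (auto simp: step_set_def)
  have irr: "step_set {A. of_int (fst A) + of_int (snd A) * sqrt 2 > 0}"
    by (auto simp: step_set_def)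
  have UNIV: "submonoid_Z2 UNIV" by (simp add: submonoid_Z2_def)
  note FH = FPP_zero[OF H(1)]
  have c4: "\<exists>X C. step_set X \<and> finite X \<and> submonoid_Z2 C \<and> \<not> (\<not> IPP X C \<longrightarrow> BPP X C)"
    using finite_not_IPP_not_BPP by blast
  \<comment> \<open>One pair refutes three converses: \<open>?H\<close> violates all geometric
    conditions, while the trivial monoid grants FPP, hence BPP and the failure of IPP.\<close>
  have "\<not> SLC ?H" "\<not> CC ?H"
    using not_LC_horizontal SLC_imp_LC CC_imp_SLC[OF H(1)] by blast+
  then have c5: "\<exists>X C. step_set X \<and> finite X \<and> submonoid_Z2 C \<and> \<not> (FPP X C \<longrightarrow> CC X)"
    and c6: "\<exists>X C. step_set X \<and> finite X \<and> submonoid_Z2 C \<and> \<not> (BPP X C \<longrightarrow> SLC X)"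
    and c7: "\<exists>X C. step_set X \<and> finite X \<and> submonoid_Z2 C \<and> \<not> (\<not> IPP X C \<longrightarrow> LC X)"
    using H submonoid_zero FH FPP_imp_BPP[OF FH]
      BPP_imp_not_IPP[OF submonoid_zero FPP_imp_BPP[OF FH]] not_LC_horizontal by blast+
  have d1: "\<exists>X C. step_set X \<and> submonoid_Z2 C \<and> \<not> (SLC X \<longrightarrow> CC X)"
    using vert UNIV SLC_vertical not_CC_vertical by blast
  have d2: "\<exists>X C. step_set X \<and> submonoid_Z2 C \<and> \<not> (LC X \<longrightarrow> SLC X)"
    using irr UNIV LC_irrational not_SLC_irrational by blast
  have d3: "\<exists>X C. step_set X \<and> submonoid_Z2 C \<and> \<not> (BPP X C \<longrightarrow> FPP X C)"
    using vert UNIV SLC_imp_BPP[OF SLC_vertical] not_FPP_vertical by blast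
  \<comment> \<open>The finite counterexamples \<open>c4\<close> to \<open>c7\<close> also serve for
    arbitrary step sets.\<close>
  show ?thesis
    by (intro conjI allI impI c4 c5 c6 c7 d1 d2 d3)
      (use CC_imp_SLC SLC_imp_LC FPP_imp_BPP BPP_imp_not_IPP CC_imp_FPP SLC_imp_BPP LC_imp_not_IPP
        finite_SLC_imp_CC finite_LC_imp_SLC finite_BPP_imp_FPP c4 c5 c6 c7 in blast)+
qed

end
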